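(* Let $X$ be a compact metric space and let $G$ be a closed relation on $X$. If $G$ or $G^{-1}$ is a well-aligned relation, then $\mathrm{ent}(G)\neq 0$.
   Context: $\rho$ denotes the metric on $X$. A closed relation on $X$ is a closed subset $G\subseteq X\times X$; $G^{-1}=\{(y,x) : (x,y)\in G\}$. $p_1,p_2:X\times X\to X$ are the projections $p_1(s,t)=s$, $p_2(s,t)=t$. Mahavier products: for each positive integer $m$, $$\star_{i=1}^{m}G^{-1}=\{(x_1,\ldots,x_{m+1})\in X^{m+1} : (x_{i+1},x_i)\in G \text{ for each } i\in\{1,\ldots,m\}\}.$$ Well-aligned: let $G$ be a closed relation on $X$ and let $L,R$ be non-empty subsets of $G$. The sets $L$ and $R$ are well-aligned in $G$ if (1) $p_2(L)\cap p_2(R)\neq\emptyset$; (2) there is $\varepsilon>0$ such that for all $t\in p_2(L)\cap p_2(R)$ there are $\ell\in p_1(p_2^{-1}(t)\cap L)$ and $r\in p_1(p_2^{-1}(t)\cap R)$ with $\rho(r,\ell)\geq\varepsilon$; (3) $p_1(L)\cup p_1(R)\subseteq p_2(L\cup R)$; (4) there is a positive integer $N$ such that for each $t\in p_2(L\cup R)$ there are a positive integer $i_0\leq N$ and a point $(a_1,\ldots,a_{i_0+1})\in\star_{i=1}^{i_0}G^{-1}$ with $a_1=t$ and $a_{i_0+1}\in p_2(L)\cap p_2(R)$. The relation $G$ is well-aligned if there are (non-empty) $L,R\subseteq G$ such that $L$ and $R$ are well-aligned in $G$. (The same definitions apply with $G^{-1}$ in place of $G$.) Entropy: for a non-empty open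 cover $\alpha$ of $X$ and a positive integer $n$ let $\alpha^{n}=\{S_1\times\cdots\times S_n : S_1,\ldots,S_n\in\alpha\}$. For a closed $K\subseteq X^n$ and a non-empty family $\mathcal U$ of open subsets of $X^n$ covering $K$, $N(K,\mathcal U)$ is the minimal cardinality of a non-empty subfamily of $\mathcal U$ that covers $K$. Define $\mathrm{ent}(G,\alpha)=\lim_{m\to\infty}\frac{\log N(\star_{i=1}^{m}G^{-1},\alpha^{m+1})}{m}$ (this limit is known to exist), and, for $G\neq\emptyset$, $\mathrm{ent}(G)=\sup_\alpha \mathrm{ent}(G,\alpha)\in[0,\infty]$, the supremum over all non-empty open covers $\alpha$ of $X$ (equal to $\infty$ if the set of values is unbounded). *)

theory Defs
  imports "HOL-Analysis.Analysis"
begin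

definition closed_relation :: "'a::metric_space set \<Rightarrow> ('a \<times> 'a) set \<Rightarrow> bool" where
  "closed_relation X G \<longleftrightarrow> closedin (top_of_set (X \<times> X)) G"

text \<open>
  A point of \<open>X\<^sup>n\<close> is an extensional function on the index set \<open>{1..n}\<close>, so that the
  coordinates are numbered from 1.  The argument \<open>H\<close> below is an arbitrary relation; entropy and
  well-alignment of \<open>G\<close> use the product of the inverse relation, \<open>H = G\<inverse>\<close>.
\<close>

definition mahavier_product ::
    "'a set \<Rightarrow> ('a \<times> 'a) set \<Rightarrow> nat \<Rightarrow> (nat \<Rightarrow> 'a) set" where
  "mahavier_product X H m =
     {x \<in> {1..m+1} \<rightarrow>\<^sub>E X. \<forall>i\<in>{1..m}. (x i, x (i+1)) \<in> H}"

definition well_aligned_sets ::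
    "'a::metric_space set \<Rightarrow> ('a \<times> 'a) set \<Rightarrow> ('a \<times> 'a) set \<Rightarrow> ('a \<times> 'a) set \<Rightarrow> bool" where
  "well_aligned_sets X G L R \<longleftrightarrow>
     L \<noteq> {} \<and> R \<noteq> {} \<and> L \<subseteq> G \<and> R \<subseteq> G \<and>
     snd ` L \<inter> snd ` R \<noteq> {} \<and>
     (\<exists>\<epsilon>>0. \<forall>t \<in> snd ` L \<inter> snd ` R.
        \<exists>l \<in> fst ` (snd -` {t} \<inter> L). \<exists>r \<in> fst ` (snd -` {t} \<inter> R). dist r l \<ge> \<epsilon>) \<and>
     fst ` L \<union> fst ` R \<subseteq> snd ` (L \<union> R) \<and>
     (\<exists>N\<ge>1. \<forall>t \<in> snd ` (L \<union> R).
        \<exists>i\<^sub>0 \<in> {1..N}. \<exists>a \<in> mahavier_product X (G\<inverse>) i\<^sub>0.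
          a 1 = t \<and> a (i\<^sub>0 + 1) \<in> snd ` L \<inter> snd ` R)"

definition well_aligned :: "'a::metric_space set \<Rightarrow> ('a \<times> 'a) set \<Rightarrow> bool" where
  "well_aligned X G \<longleftrightarrow> (\<exists>L R. well_aligned_sets X G L R)"

definition open_cover :: "'a::metric_space set \<Rightarrow> 'a set set \<Rightarrow> bool" where
  "open_cover X \<alpha> \<longleftrightarrow>
     \<alpha> \<noteq> {} \<and> (\<forall>S\<in>\<alpha>. openin (top_of_set X) S) \<and> \<Union>\<alpha> = X"

definition cover_power :: "'a set set \<Rightarrow> nat \<Rightarrow> (nat \<Rightarrow> 'a) set set" where
  "cover_power \<alpha> n = {Pi\<^sub>E {1..n} S | S. S \<in> {1..n} \<rightarrow> \<alpha>}"

text \<open>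
  The infimum is a minimum whenever \<open>\<U>\<close> has a finite subfamily covering \<open>K\<close>, which
  compactness provides in the use below.  Since the subfamily is non-empty, the value is 1 for
  \<open>K = {}\<close>, so the logarithm is harmless.
\<close>

definition min_cover_card :: "'b set \<Rightarrow> 'b set set \<Rightarrow> nat" where
  "min_cover_card K \<U> =
     Inf {card \<V> | \<V>. \<V> \<subseteq> \<U> \<and> \<V> \<noteq> {} \<and> finite \<V> \<and> K \<subseteq> \<Union>\<V>}"

definition ent_cover ::
    "'a::metric_space set \<Rightarrow> ('a \<times> 'a) set \<Rightarrow> 'a set set \<Rightarrow> real" where
  "ent_cover X G \<alpha> =
     lim (\<lambda>m. ln (real (min_cover_card (mahavier_product X (G\<inverse>) m) (cover_power \<alpha> (m+1))))
                / real m)"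

definition ent :: "'a::metric_space set \<Rightarrow> ('a \<times> 'a) set \<Rightarrow> ereal" where
  "ent X G = (SUP \<alpha>\<in>{\<alpha>. open_cover X \<alpha>}. ereal (ent_cover X G \<alpha>))"

end

theory Submission imports Defs begin

text \<open>
  Well-alignment turns the Mahavier product into a source of binary trees.  Write \<open>D = p\<^sub>2(L \<union> R)\<close>
  and \<open>T = p\<^sub>2(L) \<inter> p\<^sub>2(R)\<close>.  A path that follows \<open>G\<inverse>\<close> and stands at a point of \<open>D\<close> can be led into
  \<open>T\<close> within \<open>N\<close> steps; there it can move to either of two points that are at least \<open>\<epsilon>\<close> apart, and
  both of them lie in \<open>D\<close> again.  So each block of \<open>N + 1\<close> steps offers one free binary decision, and
  two paths that decide differently for the first time still coincide until then, hence are at the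
  same moment at distance at least \<open>\<epsilon>\<close>.  This gives \<open>2\<^sup>k\<close> paths of length \<open>k(N + 1)\<close> that are pairwise
  \<open>\<epsilon>\<close>-separated in some coordinate (\<open>well_aligned_sets_exponential_separation\<close>).

  For a cover \<open>\<alpha>\<close> by sets of diameter less than \<open>\<epsilon>\<close>, a box from \<open>\<alpha>\<close> contains at most one of these
  paths, so at least \<open>2\<^sup>k\<close> boxes are needed and \<open>ent(G, \<alpha>) \<ge> ln 2 / (N + 1)\<close>.  The entropy with respect
  to \<open>\<alpha>\<close> is given as a limit, so this conclusion depends on convergence: splitting a path of length
  \<open>m + n\<close> at its \<open>(m + 1)\<close>-st point shows that the logarithms of the covering numbers are
  subadditive, and Fekete's lemma applies.  Reversing the paths exchanges \<open>G\<close> and \<open>G\<inverse>\<close> and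
  preserves separation, which settles the case where \<open>G\<inverse>\<close> is the well-aligned relation.
\<close>

section \<open>Subadditive sequences\<close>

lemma subadditive_mult_le:
  fixes a :: "nat \<Rightarrow> real"
  assumes sub: "\<And>m n. a (m + n) \<le> a m + a n"
  shows "a (q * p + r) \<le> real q * a p + a r"
proof (induction q)
  case 0
  show ?case by simp
next
  case (Suc q)
  have "a (Suc q * p + r) \<le> a p + a (q * p + r)"
    using sub[of p "q * p + r"] by (simp add: add.assoc)
  then show ?case using Suc by (simp add: algebra_simps)
qed

text \<open>
  Fekete's lemma.  If \<open>a p / p\<close> is close to the infimum of all quotients, then division with
  remainder by \<open>p\<close> bounds \<open>a n / n\<close> by \<open>a p / p\<close> up to an error \<open>C / n\<close>, where \<open>C\<close> bounds the
  finitely many values \<open>a r\<close> at possible remainders.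
\<close>

lemma subadditive_quotient_convergent:
  fixes a :: "nat \<Rightarrow> real"
  assumes sub: "\<And>m n. a (m + n) \<le> a m + a n" and nonneg: "\<And>n. 0 \<le> a n"
  shows "convergent (\<lambda>n. a n / real n)"
proof -
  define L where "L = (INF n\<in>{1..}. a n / real n)"
  have bdd: "bdd_below ((\<lambda>n. a n / real n) ` {1..})"
    by (rule bdd_belowI2[of _ 0]) (simp add: nonneg)
  have lower: "L \<le> a n / real n" if "n \<ge> 1" for n
    unfolding L_def using that by (intro cINF_lower bdd) auto
  have "(\<lambda>n. a n / real n) \<longlonglongrightarrow> L"
  proof (rule LIMSEQ_I)
    fix e :: real assume e: "e > 0"
    have "\<exists>p\<in>{1..}. a p / real p < L + e / 2"
      using cINF_less_iff[OF _ bdd, of "L + e / 2"] e by (auto simp: L_def)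
    then obtain p where p: "p \<ge> 1" "a p / real p < L + e / 2" by auto
    define C where "C = (\<Sum>r<p. a r)"
    have C: "a r \<le> C" if "r < p" for r
      unfolding C_def using that by (intro member_le_sum) (auto simp: nonneg)
    have C0: "C \<ge> 0" unfolding C_def by (intro sum_nonneg nonneg)
    obtain M :: nat where M: "2 * C / e < real M" using reals_Archimedean2 by blast
    show "\<exists>no. \<forall>n\<ge>no. norm (a n / real n - L) < e"
    proof (intro exI allI impI)
      fix n assume n: "n \<ge> Suc M"
      then have n0: "real n > 0" by simp
      have "a n \<le> real (n div p) * a p + a (n mod p)"
        using subadditive_mult_le[of a "n div p" p "n mod p", OF sub] by simp
      also have "\<dots> \<le> real (n div p) * a p + C"
        using C[of "n mod p"] p by simp
      also have "real (n div p) * a p = real (n div p * p) * (a p / real p)"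
        using p by simp
      also have "\<dots> \<le> real n * (a p / real p)"
        by (intro mult_right_mono of_nat_mono) (simp_all add: nonneg)
      finally have "a n \<le> real n * (a p / real p) + C" by simp
      then have "a n / real n \<le> a p / real p + C / real n"
        using n0 by (simp add: field_simps)
      moreover have "C / real n < e / 2"
      proof -
        have "2 * C / e < real n" using M n by linarith
        then show ?thesis using e n0 by (simp add: field_simps)
      qed
      ultimately have "a n / real n < L + e" using p by linarith
      moreover have "L \<le> a n / real n" using n by (intro lower) simp
      ultimately show "norm (a n / real n - L) < e" by simp
    qed
  qed
  then show ?thesis by (auto simp: convergent_def)
qed

section \<open>Paths in Mahavier products\<close>

text \<open>
  Concatenation of a path with \<open>p\<close> steps and a path that starts where it ends.  The shared point is
  taken from \<open>b\<close>, so the result is undefined past its end as soon as \<open>b\<close> is.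
\<close>

definition path_join :: "nat \<Rightarrow> (nat \<Rightarrow> 'a) \<Rightarrow> (nat \<Rightarrow> 'a) \<Rightarrow> nat \<Rightarrow> 'a" where
  "path_join p a b = (\<lambda>i. if i \<le> p then a i else b (i - p))"

lemma path_join_left: "i \<le> p \<Longrightarrow> path_join p a b i = a i"
  and path_join_right: "1 \<le> j \<Longrightarrow> path_join p a b (p + j) = b j"
  by (simp_all add: path_join_def)

lemma path_join_mahavier_product:
  assumes a: "a \<in> mahavier_product X H p" and b: "b \<in> mahavier_product X H q"
    and meet: "a (p + 1) = b 1"
  shows "path_join p a b \<in> mahavier_product X H (p + q)"
proof -
  have aX: "a i \<in> X" if "i \<in> {1..p+1}" for i
    using a that by (auto simp: mahavier_product_def)
  have bX: "b i \<in> X" if "i \<in> {1..q+1}" for i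
    using b that by (auto simp: mahavier_product_def)
  have aH: "(a i, a (i+1)) \<in> H" if "i \<in> {1..p}" for i
    using a that by (auto simp: mahavier_product_def)
  have bH: "(b i, b (i+1)) \<in> H" if "i \<in> {1..q}" for i
    using b that by (auto simp: mahavier_product_def)
  have bu: "b i = undefined" if "i \<notin> {1..q+1}" for i
    using b that by (auto simp: mahavier_product_def PiE_def extensional_def)
  have au: "a 0 = undefined"
    using a by (auto simp: mahavier_product_def PiE_def extensional_def)
  have "path_join p a b \<in> {1..p+q+1} \<rightarrow>\<^sub>E X"
  proof (rule PiE_I)
    fix i assume "i \<in> {1..p+q+1}"
    then have "i \<le> p \<Longrightarrow> i \<in> {1..p+1}" "\<not> i \<le> p \<Longrightarrow> i - p \<in> {1..q+1}" by auto
    then show "path_join p a b i \<in> X"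
      using aX[of i] bX[of "i - p"] by (cases "i \<le> p") (simp_all add: path_join_def)
  next
    fix i assume i: "i \<notin> {1..p+q+1}"
    show "path_join p a b i = undefined"
    proof (cases "i = 0")
      case True
      then show ?thesis using au by (simp add: path_join_def)
    next
      case False
      then have "i - p \<notin> {1..q+1}" "\<not> i \<le> p" using i by auto
      then show ?thesis using bu by (simp add: path_join_def)
    qed
  qed
  moreover have "(path_join p a b i, path_join p a b (i+1)) \<in> H" if "i \<in> {1..p+q}" for i
  proof -
    consider "i < p" | "i = p" | "i > p" by linarith
    then show ?thesis
    proof cases
      case 1
      then show ?thesis using that aH[of i] by (simp add: path_join_def)
    next
      case 2
      then show ?thesis using that aH[of i] meet by (simp add: path_join_def)
    next
      case 3
      then have "i + 1 - p = i - p + 1" "i - p \<in> {1..q}" using that by auto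
      then show ?thesis using 3 bH[of "i - p"] by (simp add: path_join_def)
    qed
  qed
  ultimately show ?thesis by (simp add: mahavier_product_def)
qed

lemma mahavier_product_single_edge:
  assumes "(s, t) \<in> H" "s \<in> X" "t \<in> X"
  shows "(\<lambda>i\<in>{1..2}. if i = 1 then s else t) \<in> mahavier_product X H 1"
  using assms by (auto simp: mahavier_product_def)

lemma mahavier_product_prefix:
  assumes "x \<in> mahavier_product X H (m + n)"
  shows "restrict x {1..m+1} \<in> mahavier_product X H m"
  using assms by (auto simp: mahavier_product_def)

lemma mahavier_product_suffix:
  assumes "x \<in> mahavier_product X H (m + n)"
  shows "(\<lambda>i\<in>{1..n+1}. x (m + i)) \<in> mahavier_product X H n"
proof -
  have "x i \<in> X" if "i \<in> {1..m+n+1}" for i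
    using assms that by (auto simp: mahavier_product_def)
  moreover have "(x i, x (i+1)) \<in> H" if "i \<in> {1..m+n}" for i
    using assms that by (auto simp: mahavier_product_def)
  from this[of "m + _"] have "(x (m + i), x (m + i + 1)) \<in> H" if "i \<in> {1..n}" for i
    using that by simp
  ultimately show ?thesis by (auto simp: mahavier_product_def)
qed

lemma mahavier_product_reverse:
  assumes "x \<in> mahavier_product X H m"
  shows "(\<lambda>i\<in>{1..m+1}. x (m + 2 - i)) \<in> mahavier_product X (H\<inverse>) m"
proof -
  have X: "x i \<in> X" if "i \<in> {1..m+1}" for i
    using assms that by (auto simp: mahavier_product_def)
  have H: "(x i, x (i+1)) \<in> H" if "i \<in> {1..m}" for i
    using assms that by (auto simp: mahavier_product_def)
  have "(x (m + 2 - (i+1)), x (m + 2 - i)) \<in> H" if "i \<in> {1..m}" for i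
  proof -
    have "m + 2 - i = m + 2 - (i+1) + 1" "m + 2 - (i+1) \<in> {1..m}" using that by auto
    then show ?thesis using H[of "m + 2 - (i+1)"] by simp
  qed
  moreover have "x (m + 2 - i) \<in> X" if "i \<in> {1..m+1}" for i
    using that by (intro X) auto
  ultimately show ?thesis by (auto simp: mahavier_product_def)
qed

section \<open>Covering numbers and their growth\<close>

lemma cover_power_image: "cover_power \<alpha> n = Pi\<^sub>E {1..n} ` ({1..n} \<rightarrow> \<alpha>)"
  by (auto simp: cover_power_def)

lemma finite_cover_power:
  assumes "finite \<beta>"
  shows "finite (cover_power \<beta> n)"
proof -
  have "cover_power \<beta> n \<subseteq> Pi\<^sub>E {1..n} ` ({1..n} \<rightarrow>\<^sub>E \<beta>)"
  proof
    fix U assume "U \<in> cover_power \<beta> n"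
    then obtain S where S: "S \<in> {1..n} \<rightarrow> \<beta>" "U = Pi\<^sub>E {1..n} S"
      by (auto simp: cover_power_def)
    have "U = Pi\<^sub>E {1..n} (restrict S {1..n})"
      unfolding S(2) by (intro PiE_cong) simp
    moreover have "restrict S {1..n} \<in> {1..n} \<rightarrow>\<^sub>E \<beta>" using S(1) by auto
    ultimately show "U \<in> Pi\<^sub>E {1..n} ` ({1..n} \<rightarrow>\<^sub>E \<beta>)" by blast
  qed
  then show ?thesis
    by (rule finite_subset) (intro finite_imageI finite_PiE assms finite_atLeastAtMost)
qed

text \<open>
  The boxes with sides in a finite subcover of the base space form a finite family, and they cover
  the whole power of \<open>X\<close>.
\<close>

lemma finite_box_cover_exists:
  assumes "compact X" "open_cover X \<alpha>" "K \<subseteq> {1..n} \<rightarrow>\<^sub>E X"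
  shows "\<exists>\<V>. \<V> \<subseteq> cover_power \<alpha> n \<and> \<V> \<noteq> {} \<and> finite \<V> \<and> K \<subseteq> \<Union>\<V>"
proof -
  from assms(2) have \<alpha>: "\<alpha> \<noteq> {}" "\<And>S. S \<in> \<alpha> \<Longrightarrow> openin (top_of_set X) S" "X = \<Union>\<alpha>"
    by (auto simp: open_cover_def)
  obtain \<beta>0 where \<beta>0: "\<beta>0 \<subseteq> \<alpha>" "finite \<beta>0" "X \<subseteq> \<Union>\<beta>0"
    using assms(1) \<alpha>(2,3) unfolding compact_eq_openin_cover
    by (metis order_refl)
  \<comment> \<open>One more member keeps the family of boxes non-empty even if \<open>X\<close> is empty.\<close>
  obtain A where A: "A \<in> \<alpha>" using \<alpha>(1) by auto
  define \<beta> where "\<beta> = insert A \<beta>0"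
  have \<beta>: "\<beta> \<subseteq> \<alpha>" "finite \<beta>" "X \<subseteq> \<Union>\<beta>" using \<beta>0 A by (auto simp: \<beta>_def)
  have "cover_power \<beta> n \<subseteq> cover_power \<alpha> n"
    using \<beta>(1) by (auto simp: cover_power_def)
  moreover have "Pi\<^sub>E {1..n} (\<lambda>_. A) \<in> cover_power \<beta> n"
    unfolding cover_power_image by (rule imageI) (auto simp: \<beta>_def)
  moreover have "K \<subseteq> \<Union>(cover_power \<beta> n)"
  proof
    fix x assume "x \<in> K"
    then have x: "x \<in> {1..n} \<rightarrow>\<^sub>E X" using assms(3) by auto
    then have "\<forall>i\<in>{1..n}. \<exists>S\<in>\<beta>. x i \<in> S" using \<beta>(3) by blast
    then obtain S where S: "\<And>i. i \<in> {1..n} \<Longrightarrow> S i \<in> \<beta> \<and> x i \<in> S i" by metis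
    then have "x \<in> Pi\<^sub>E {1..n} S" using x by auto
    moreover have "Pi\<^sub>E {1..n} S \<in> cover_power \<beta> n"
      unfolding cover_power_image using S by blast
    ultimately show "x \<in> \<Union>(cover_power \<beta> n)" by blast
  qed
  ultimately show ?thesis using finite_cover_power[OF \<beta>(2), of n] by blast
qed

lemma min_cover_card_le:
  assumes "\<V> \<subseteq> \<U>" "\<V> \<noteq> {}" "finite \<V>" "K \<subseteq> \<Union>\<V>"
  shows "min_cover_card K \<U> \<le> card \<V>"
  unfolding min_cover_card_def using assms by (intro cInf_lower) auto

lemma min_cover_card_attained:
  assumes "\<exists>\<V>. \<V> \<subseteq> \<U> \<and> \<V> \<noteq> {} \<and> finite \<V> \<and> K \<subseteq> \<Union>\<V>"
  obtains \<V> where "\<V> \<subseteq> \<U>" "\<V> \<noteq> {}" "finite \<V>" "K \<subseteq> \<Union>\<V>" "card \<V> = min_cover_card K \<U>"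
proof -
  let ?C = "{card \<V> | \<V>. \<V> \<subseteq> \<U> \<and> \<V> \<noteq> {} \<and> finite \<V> \<and> K \<subseteq> \<Union>\<V>}"
  have "?C \<noteq> {}" using assms by blast
  then have "min_cover_card K \<U> \<in> ?C"
    unfolding min_cover_card_def by (rule Inf_nat_def1)
  then obtain \<V> where "min_cover_card K \<U> = card \<V>"
    "\<V> \<subseteq> \<U> \<and> \<V> \<noteq> {} \<and> finite \<V> \<and> K \<subseteq> \<Union>\<V>"
    by (rule CollectE) (elim exE conjE, blast)
  then show ?thesis by (intro that[of \<V>]) simp_all
qed

text \<open>
  Boxes are handled through the functions listing their sides: given side lists for the first
  \<open>m + 1\<close> and the last \<open>n + 1\<close> coordinates, one joins them and drops the second demand on the
  shared coordinate \<open>m + 1\<close>.  Dropping it only enlarges the box, so the joined boxes still cover.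
\<close>

lemma min_cover_card_submultiplicative:
  fixes X :: "'a::metric_space set"
  assumes X: "compact X" and \<alpha>: "open_cover X \<alpha>"
  shows "min_cover_card (mahavier_product X H (m + n)) (cover_power \<alpha> (m + n + 1))
    \<le> min_cover_card (mahavier_product X H m) (cover_power \<alpha> (m + 1))
      * min_cover_card (mahavier_product X H n) (cover_power \<alpha> (n + 1))"
proof -
  have K: "mahavier_product X H j \<subseteq> {1..j+1} \<rightarrow>\<^sub>E X" for j
    by (auto simp: mahavier_product_def)
  have optimal: "\<exists>\<S>. \<S> \<subseteq> {1..j+1} \<rightarrow> \<alpha> \<and> \<S> \<noteq> {} \<and> finite \<S>
      \<and> mahavier_product X H j \<subseteq> (\<Union>S\<in>\<S>. Pi\<^sub>E {1..j+1} S)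
      \<and> card \<S> = min_cover_card (mahavier_product X H j) (cover_power \<alpha> (j + 1))" for j
  proof -
    obtain \<V> where \<V>: "\<V> \<subseteq> cover_power \<alpha> (j+1)" "\<V> \<noteq> {}" "finite \<V>"
      "mahavier_product X H j \<subseteq> \<Union>\<V>"
      "card \<V> = min_cover_card (mahavier_product X H j) (cover_power \<alpha> (j + 1))"
      by (rule min_cover_card_attained[OF finite_box_cover_exists[OF X \<alpha> K[of j]]])
    from \<V>(1) obtain \<S> where "\<S> \<subseteq> {1..j+1} \<rightarrow> \<alpha>" "inj_on (Pi\<^sub>E {1..j+1}) \<S>"
      "\<V> = Pi\<^sub>E {1..j+1} ` \<S>"
      unfolding cover_power_image subset_image_inj by auto
    with \<V> show ?thesis
      by (intro exI[of _ \<S>]) (auto simp: card_image finite_image_iff)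
  qed
  obtain \<S> where \<S>: "\<S> \<subseteq> {1..m+1} \<rightarrow> \<alpha>" "\<S> \<noteq> {}" "finite \<S>"
    "mahavier_product X H m \<subseteq> (\<Union>S\<in>\<S>. Pi\<^sub>E {1..m+1} S)"
    "card \<S> = min_cover_card (mahavier_product X H m) (cover_power \<alpha> (m + 1))"
    using optimal[of m] by blast
  obtain \<T> where \<T>: "\<T> \<subseteq> {1..n+1} \<rightarrow> \<alpha>" "\<T> \<noteq> {}" "finite \<T>"
    "mahavier_product X H n \<subseteq> (\<Union>S\<in>\<T>. Pi\<^sub>E {1..n+1} S)"
    "card \<T> = min_cover_card (mahavier_product X H n) (cover_power \<alpha> (n + 1))"
    using optimal[of n] by blast
  define glue where "glue = (\<lambda>(S, S' :: nat \<Rightarrow> 'a set). Pi\<^sub>E {1..m+n+1} (path_join (m+1) S (\<lambda>i. S' (i + 1 :: nat))))"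
  let ?\<V> = "glue ` (\<S> \<times> \<T>)"
  have "?\<V> \<subseteq> cover_power \<alpha> (m + n + 1)"
  proof
    fix U assume "U \<in> ?\<V>"
    then obtain S S' where S: "S \<in> \<S>" "S' \<in> \<T>"
      "U = Pi\<^sub>E {1..m+n+1} (path_join (m+1) S (\<lambda>i. S' (i + 1)))"
      by (auto simp: glue_def)
    have "path_join (m+1) S (\<lambda>i. S' (i + 1)) i \<in> \<alpha>" if i: "i \<in> {1..m+n+1}" for i
    proof (cases "i \<le> m + 1")
      case True
      then have "S i \<in> \<alpha>" using i S(1) \<S>(1) by (auto simp: Pi_def)
      then show ?thesis using True by (simp add: path_join_def)
    next
      case False
      then have "i - (m+1) + 1 \<in> {1..n+1}" using i by auto
      then have "S' (i - (m+1) + 1) \<in> \<alpha>" using S(2) \<T>(1) by (auto simp: Pi_def)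
      then show ?thesis using False by (simp add: path_join_def)
    qed
    then show "U \<in> cover_power \<alpha> (m + n + 1)"
      unfolding cover_power_image S(3) by blast
  qed
  moreover have "mahavier_product X H (m + n) \<subseteq> \<Union>?\<V>"
  proof
    fix x assume x: "x \<in> mahavier_product X H (m + n)"
    obtain S where S: "S \<in> \<S>" "restrict x {1..m+1} \<in> Pi\<^sub>E {1..m+1} S"
      using mahavier_product_prefix[OF x] \<S>(4) by blast
    obtain S' where S': "S' \<in> \<T>" "(\<lambda>i\<in>{1..n+1}. x (m + i)) \<in> Pi\<^sub>E {1..n+1} S'"
      using mahavier_product_suffix[OF x] \<T>(4) by blast
    have l: "x i \<in> S i" if "i \<in> {1..m+1}" for i
      using PiE_mem[OF S(2) that] that by simp
    have r: "x (m + i) \<in> S' i" if "i \<in> {1..n+1}" for i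
      using PiE_mem[OF S'(2) that] that by simp
    have "x \<in> Pi\<^sub>E {1..m+n+1} (path_join (m+1) S (\<lambda>i. S' (i + 1)))"
    proof (rule PiE_I)
      fix i assume i: "i \<in> {1..m+n+1}"
      show "x i \<in> path_join (m+1) S (\<lambda>i. S' (i + 1)) i"
      proof (cases "i \<le> m + 1")
        case True
        then show ?thesis using l[of i] i by (simp add: path_join_def)
      next
        case False
        then have "i = m + (i - (m+1) + 1)" "i - (m+1) + 1 \<in> {1..n+1}" using i by auto
        then show ?thesis using r[of "i - (m+1) + 1"] False by (simp add: path_join_def)
      qed
    next
      fix i assume "i \<notin> {1..m+n+1}"
      then show "x i = undefined" using x by (auto simp: mahavier_product_def PiE_def extensional_def)
    qed
    then show "x \<in> \<Union>?\<V>" using S(1) S'(1) by (auto simp: glue_def)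
  qed
  ultimately have "min_cover_card (mahavier_product X H (m + n)) (cover_power \<alpha> (m + n + 1))
      \<le> card ?\<V>"
    using \<S>(2,3) \<T>(2,3) by (intro min_cover_card_le) auto
  also have "\<dots> \<le> card (\<S> \<times> \<T>)" using \<S>(3) \<T>(3) by (intro card_image_le) auto
  also have "\<dots> = card \<S> * card \<T>" by (rule card_cartesian_product)
  finally show ?thesis using \<S>(5) \<T>(5) by simp
qed

lemma min_cover_card_pos:
  fixes X :: "'a::metric_space set"
  assumes "compact X" "open_cover X \<alpha>"
  shows "min_cover_card (mahavier_product X H m) (cover_power \<alpha> (m + 1)) \<ge> 1"
proof -
  have "mahavier_product X H m \<subseteq> {1..m+1} \<rightarrow>\<^sub>E X"
    by (auto simp: mahavier_product_def)
  from finite_box_cover_exists[OF assms this]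
  obtain \<V> where "\<V> \<subseteq> cover_power \<alpha> (m + 1)" "\<V> \<noteq> {}" "finite \<V>"
    "mahavier_product X H m \<subseteq> \<Union>\<V>"
    "card \<V> = min_cover_card (mahavier_product X H m) (cover_power \<alpha> (m + 1))"
    by (rule min_cover_card_attained)
  moreover from \<open>\<V> \<noteq> {}\<close> \<open>finite \<V>\<close> have "card \<V> > 0" by (simp add: card_gt_0_iff)
  ultimately show ?thesis by linarith
qed

lemma entropy_sequence_convergent:
  fixes X :: "'a::metric_space set"
  assumes "compact X" "open_cover X \<alpha>"
  shows "convergent (\<lambda>m. ln (real (min_cover_card (mahavier_product X H m)
    (cover_power \<alpha> (m + 1)))) / real m)"
proof (rule subadditive_quotient_convergent)
  fix m n
  let ?c = "\<lambda>m. min_cover_card (mahavier_product X H m) (cover_power \<alpha> (m + 1))"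
  have pos: "real (?c j) \<ge> 1" for j using min_cover_card_pos[OF assms, of H j] by linarith
  show "0 \<le> ln (real (?c m))" using pos[of m] by simp
  have "real (?c (m + n)) \<le> real (?c m * ?c n)"
    using min_cover_card_submultiplicative[OF assms, of H m n] by (intro of_nat_mono) simp
  then have "ln (real (?c (m + n))) \<le> ln (real (?c m) * real (?c n))"
    using pos[of "m + n"] by (intro ln_mono) auto
  also have "\<dots> = ln (real (?c m)) + ln (real (?c n))"
    using pos[of m] pos[of n] by (intro ln_mult_pos) auto
  finally show "ln (real (?c (m + n))) \<le> ln (real (?c m)) + ln (real (?c n))" .
qed

section \<open>Separated families of paths\<close>

definition separated :: "real \<Rightarrow> nat \<Rightarrow> (nat \<Rightarrow> 'a::metric_space) set \<Rightarrow> bool" where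
  "separated \<epsilon> n E \<longleftrightarrow>
     (\<forall>x\<in>E. \<forall>y\<in>E. x \<noteq> y \<longrightarrow> (\<exists>i\<in>{1..n}. dist (x i) (y i) \<ge> \<epsilon>))"

lemma separatedE:
  assumes "separated \<epsilon> n E" "x \<in> E" "y \<in> E" "x \<noteq> y"
  obtains i where "i \<in> {1..n}" "dist (x i) (y i) \<ge> \<epsilon>"
  using assms unfolding separated_def by blast

lemma separated_card_le_min_cover_card:
  fixes X :: "'a::metric_space set"
  assumes X: "compact X" and \<alpha>: "open_cover X \<alpha>"
    and small: "\<And>S x y. S \<in> \<alpha> \<Longrightarrow> x \<in> S \<Longrightarrow> y \<in> S \<Longrightarrow> dist x y < \<epsilon>"
    and E: "E \<subseteq> K" "separated \<epsilon> n E" and K: "K \<subseteq> {1..n} \<rightarrow>\<^sub>E X"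
  shows "card E \<le> min_cover_card K (cover_power \<alpha> n)"
proof -
  obtain \<V> where \<V>: "\<V> \<subseteq> cover_power \<alpha> n" "finite \<V>" "K \<subseteq> \<Union>\<V>"
    "card \<V> = min_cover_card K (cover_power \<alpha> n)"
    by (rule min_cover_card_attained[OF finite_box_cover_exists[OF X \<alpha> K]])
  from \<V>(3) E(1) have "\<forall>x\<in>E. \<exists>V\<in>\<V>. x \<in> V" by blast
  then obtain f where f: "\<And>x. x \<in> E \<Longrightarrow> f x \<in> \<V> \<and> x \<in> f x" by metis
  have "inj_on f E"
  proof (rule inj_onI, rule ccontr)
    fix x y assume xy: "x \<in> E" "y \<in> E" "f x = f y" "x \<noteq> y"
    obtain i where i: "i \<in> {1..n}" "dist (x i) (y i) \<ge> \<epsilon>"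
      by (rule separatedE[OF E(2) xy(1,2,4)])
    from f[OF xy(1)] \<V>(1) obtain S where S: "S \<in> {1..n} \<rightarrow> \<alpha>" "f x = Pi\<^sub>E {1..n} S"
      by (auto simp: cover_power_def)
    have "x i \<in> S i" "y i \<in> S i" "S i \<in> \<alpha>"
      using f[OF xy(1)] f[OF xy(2)] S xy(3) i(1) by (auto simp: PiE_def Pi_def)
    then show False using small i(2) by force
  qed
  moreover have "f ` E \<subseteq> \<V>" using f by auto
  ultimately show ?thesis using card_inj_on_le[of f E \<V>] \<V>(2,4) by simp
qed

text \<open>
  Only the lengths \<open>k p\<close> carry information, which suffices because the whole sequence of normalised
  logarithms converges.
\<close>

lemma ent_pos_of_exponential_separation:
  fixes X :: "'a::metric_space set"
  assumes X: "compact X" "X \<noteq> {}" and \<epsilon>: "\<epsilon> > 0" and p: "p \<ge> 1"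
    and E: "\<And>k. \<exists>E \<subseteq> mahavier_product X (G\<inverse>) (k * p). card E = 2 ^ k \<and> separated \<epsilon> (k * p + 1) E"
  shows "ent X G > 0"
proof -
  define \<alpha> where "\<alpha> = (\<lambda>x. X \<inter> ball x (\<epsilon> / 2)) ` X"
  have \<alpha>: "open_cover X \<alpha>"
    unfolding open_cover_def \<alpha>_def using X(2) \<epsilon>
    by (auto intro!: openin_open_Int)
  have small: "dist x y < \<epsilon>" if "S \<in> \<alpha>" "x \<in> S" "y \<in> S" for S x y
  proof -
    from that obtain z where "dist z x < \<epsilon> / 2" "dist z y < \<epsilon> / 2"
      by (auto simp: \<alpha>_def)
    then show ?thesis using dist_triangle3[of x y z] by linarith
  qed
  let ?c = "\<lambda>m. min_cover_card (mahavier_product X (G\<inverse>) m) (cover_power \<alpha> (m + 1))"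
  let ?q = "\<lambda>m. ln (real (?c m)) / real m"
  have lim: "?q \<longlonglongrightarrow> ent_cover X G \<alpha>"
    unfolding ent_cover_def
    using entropy_sequence_convergent[OF X(1) \<alpha>] by (simp only: convergent_LIMSEQ_iff)
  have mono: "strict_mono (\<lambda>k. Suc k * p)" using p by (auto simp: strict_mono_Suc_iff)
  have "ln 2 / real p \<le> ?q (Suc k * p)" for k
  proof -
    obtain E where E': "E \<subseteq> mahavier_product X (G\<inverse>) (Suc k * p)" "card E = 2 ^ Suc k"
      "separated \<epsilon> (Suc k * p + 1) E" using E by blast
    have "2 ^ Suc k \<le> ?c (Suc k * p)"
      using separated_card_le_min_cover_card[OF X(1) \<alpha> small E'(1,3)] E'(2)
      by (simp add: mahavier_product_def subset_iff)
    then have "(2::real) ^ Suc k \<le> real (?c (Suc k * p))"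
      by (metis of_nat_le_iff of_nat_numeral of_nat_power)
    then have "ln ((2::real) ^ Suc k) \<le> ln (real (?c (Suc k * p)))"
      by (intro ln_mono) auto
    then have "real (Suc k) * ln 2 \<le> ln (real (?c (Suc k * p)))"
      by (simp only: ln_realpow)
    then have "real (Suc k) * ln 2 / real (Suc k * p) \<le> ?q (Suc k * p)"
      by (intro divide_right_mono) auto
    moreover have "real (Suc k) * ln 2 / real (Suc k * p) = ln 2 / real p"
      unfolding of_nat_mult by (rule nonzero_mult_divide_mult_cancel_left) simp
    ultimately show ?thesis by simp
  qed
  then have "ln 2 / real p \<le> ent_cover X G \<alpha>"
    using LIMSEQ_subseq_LIMSEQ[OF lim mono]
    by (intro LIMSEQ_le_const[where X = "?q \<circ> (\<lambda>k. Suc k * p)"]) auto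
  moreover have "0 < ln 2 / real p" using p by simp
  ultimately have "0 < ereal (ent_cover X G \<alpha>)" by simp
  also have "\<dots> \<le> ent X G"
    unfolding ent_def using \<alpha> by (intro SUP_upper) simp
  finally show ?thesis .
qed

lemma separated_reverse:
  assumes "E \<subseteq> mahavier_product X H m" "separated \<epsilon> (m + 1) E" "\<epsilon> > 0"
  shows "\<exists>E' \<subseteq> mahavier_product X (H\<inverse>) m. card E' = card E \<and> separated \<epsilon> (m + 1) E'"
proof -
  define rv where "rv = (\<lambda>x :: nat \<Rightarrow> 'a. \<lambda>i\<in>{1..m+1}. x (m + 2 - i))"
  have apart: "\<exists>i\<in>{1..m+1}. dist (rv x i) (rv y i) \<ge> \<epsilon>"
    if xy: "x \<in> E" "y \<in> E" "x \<noteq> y" for x y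
  proof -
    obtain i where i: "i \<in> {1..m+1}" "dist (x i) (y i) \<ge> \<epsilon>"
      by (rule separatedE[OF assms(2) xy])
    then have "m + 2 - i \<in> {1..m+1}" "m + 2 - (m + 2 - i) = i" by auto
    then show ?thesis using i(2) by (intro bexI[of _ "m + 2 - i"]) (simp_all add: rv_def)
  qed
  have "inj_on rv E"
    using apart assms(3) by (intro inj_onI) (metis dist_self not_le)
  then have "card (rv ` E) = card E" by (rule card_image)
  moreover have "rv ` E \<subseteq> mahavier_product X (H\<inverse>) m"
    using assms(1) mahavier_product_reverse unfolding rv_def by blast
  moreover have "separated \<epsilon> (m + 1) (rv ` E)"
    unfolding separated_def using apart by auto
  ultimately show ?thesis by blast
qed

text \<open>
  The branching step: two separated families of paths can be grafted onto two prefixes of equal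
  length whose end points are \<open>\<epsilon>\<close> apart, and the numbers of paths add up.
\<close>

lemma separated_graft:
  fixes X :: "'a::metric_space set"
  assumes \<epsilon>: "\<epsilon> > 0"
    and a: "a \<in> mahavier_product X H p" "a (p + 1) = u"
    and b: "b \<in> mahavier_product X H p" "b (p + 1) = v"
    and start: "a 1 = t" "b 1 = t" "p \<ge> 1"
    and fork: "dist u v \<ge> \<epsilon>"
    and A: "A \<subseteq> {x \<in> mahavier_product X H q. x 1 = u}" "finite A" "separated \<epsilon> (q + 1) A"
    and B: "B \<subseteq> {x \<in> mahavier_product X H q. x 1 = v}" "finite B" "separated \<epsilon> (q + 1) B"
  shows "\<exists>E \<subseteq> {x \<in> mahavier_product X H (p + q). x 1 = t}.
    finite E \<and> card E = card A + card B \<and> separated \<epsilon> (p + q + 1) E"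
proof -
  have within: "\<exists>i\<in>{1..p+q+1}. dist (path_join p c x i) (path_join p c y i) \<ge> \<epsilon>"
    if C: "C \<in> {A, B}" and xy: "x \<in> C" "y \<in> C" "x \<noteq> y" for C c x y
  proof -
    have "separated \<epsilon> (q + 1) C" using A(3) B(3) C by blast
    then obtain i where "i \<in> {1..q+1}" "dist (x i) (y i) \<ge> \<epsilon>"
      using xy by (rule separatedE)
    then show ?thesis
      by (intro bexI[of _ "p + i"]) (simp_all add: path_join_right)
  qed
  have between: "\<epsilon> \<le> dist (path_join p a x (p + 1)) (path_join p b y (p + 1))"
    if "x \<in> A" "y \<in> B" for x y
  proof -
    have "x 1 = u" "y 1 = v" using that A(1) B(1) by auto
    then show ?thesis using fork by (simp add: path_join_def)
  qed
  let ?A = "path_join p a ` A" and ?B = "path_join p b ` B"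
  have "inj_on (path_join p c) C" if "C \<in> {A, B}" for c C
  proof (rule inj_onI, rule ccontr)
    fix x y assume "x \<in> C" "y \<in> C" "path_join p c x = path_join p c y" "x \<noteq> y"
    then show False using within[OF that, of x y c] \<epsilon> by simp
  qed
  then have "inj_on (path_join p a) A" "inj_on (path_join p b) B" by simp_all
  moreover have "?A \<inter> ?B = {}"
  proof -
    have "path_join p a x \<noteq> path_join p b y" if "x \<in> A" "y \<in> B" for x y
      using between[OF that] \<epsilon> by auto
    then show ?thesis by blast
  qed
  ultimately have "card (?A \<union> ?B) = card A + card B"
    using A(2) B(2) by (simp add: card_Un_disjoint card_image)
  moreover have "separated \<epsilon> (p + q + 1) (?A \<union> ?B)"
    unfolding separated_def
  proof (intro ballI impI)
    fix x y assume xy: "x \<in> ?A \<union> ?B" "y \<in> ?A \<union> ?B" "x \<noteq> y"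
    have mid: "p + 1 \<in> {1..p+q+1}" by simp
    from xy consider
        x' y' where "x' \<in> A" "y' \<in> A" "x = path_join p a x'" "y = path_join p a y'"
      | x' y' where "x' \<in> B" "y' \<in> B" "x = path_join p b x'" "y = path_join p b y'"
      | x' y' where "x' \<in> A" "y' \<in> B" "x = path_join p a x'" "y = path_join p b y'"
      | x' y' where "y' \<in> A" "x' \<in> B" "x = path_join p b x'" "y = path_join p a y'"
      by blast
    then show "\<exists>i\<in>{1..p+q+1}. dist (x i) (y i) \<ge> \<epsilon>"
    proof cases
      case 1
      then show ?thesis using within[of A x' y' a] xy(3) by auto
    next
      case 2
      then show ?thesis using within[of B x' y' b] xy(3) by auto
    next
      case 3
      then show ?thesis using between[of x' y'] mid by metis
    next
      case 4
      then show ?thesis using between[of y' x'] mid by (metis dist_commute)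
    qed
  qed
  moreover have "?A \<union> ?B \<subseteq> {x \<in> mahavier_product X H (p + q). x 1 = t}"
  proof -
    have "path_join p a x \<in> mahavier_product X H (p + q)" if "x \<in> A" for x
      using that A(1) a by (intro path_join_mahavier_product) auto
    moreover have "path_join p b x \<in> mahavier_product X H (p + q)" if "x \<in> B" for x
      using that B(1) b by (intro path_join_mahavier_product) auto
    ultimately show ?thesis using start by (auto simp: path_join_left)
  qed
  ultimately show ?thesis using A(2) B(2) by (intro exI[of _ "?A \<union> ?B"]) auto
qed

section \<open>Branching in well-aligned relations\<close>

text \<open>
  A bound on the waiting time does not make the moments of branching regular.  The induction
  therefore speaks of all lengths \<open>m \<ge> k (N + 1)\<close>, and a path that has exhausted its branchings is
  prolonged inside \<open>p\<^sub>2(L \<union> R)\<close> as far as needed.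
\<close>

lemma well_aligned_sets_exponential_separation:
  fixes X :: "'a::metric_space set"
  assumes wa: "well_aligned_sets X G L R" and G: "G \<subseteq> X \<times> X"
  shows "\<exists>\<epsilon>>0. \<exists>p\<ge>1. \<forall>k. \<exists>E \<subseteq> mahavier_product X (G\<inverse>) (k * p).
    card E = 2 ^ k \<and> separated \<epsilon> (k * p + 1) E"
proof -
  define D where "D = snd ` (L \<union> R)"
  define T where "T = snd ` L \<inter> snd ` R"
  have LR: "L \<noteq> {}" "L \<subseteq> G" "R \<subseteq> G" using wa by (auto simp: well_aligned_sets_def)
  have DX: "D \<subseteq> X" using LR G by (auto simp: D_def)
  have return_D: "fst ` L \<union> fst ` R \<subseteq> D" using wa by (auto simp: well_aligned_sets_def D_def)
  from wa obtain \<epsilon> where \<epsilon>: "\<epsilon> > 0" and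
    choice: "\<forall>t\<in>T. \<exists>l \<in> fst ` (snd -` {t} \<inter> L). \<exists>r \<in> fst ` (snd -` {t} \<inter> R). dist r l \<ge> \<epsilon>"
    unfolding well_aligned_sets_def T_def by blast
  have fork: "\<exists>l\<in>D. \<exists>r\<in>D. (l, t) \<in> G \<and> (r, t) \<in> G \<and> dist l r \<ge> \<epsilon>" if "t \<in> T" for t
  proof -
    from choice that obtain l r where "(l, t) \<in> L" "(r, t) \<in> R" "dist r l \<ge> \<epsilon>" by force
    moreover from this have "l \<in> D" "r \<in> D" using return_D by force+
    ultimately show ?thesis using LR by (metis dist_commute subsetD)
  qed
  from wa obtain N where
    reach: "\<And>t. t \<in> D \<Longrightarrow> \<exists>i\<in>{1..N}. \<exists>a \<in> mahavier_product X (G\<inverse>) i. a 1 = t \<and> a (i + 1) \<in> T"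
    unfolding well_aligned_sets_def D_def T_def by metis

  have prolong: "\<exists>x \<in> mahavier_product X (G\<inverse>) m. x 1 = t" if "t \<in> D" for m t
    using that
  proof (induction m arbitrary: t)
    case 0
    then show ?case using DX
      by (intro bexI[of _ "\<lambda>i\<in>{1..1}. t"]) (auto simp: mahavier_product_def)
  next
    case (Suc m)
    from Suc.prems obtain s where st: "(s, t) \<in> L \<union> R" unfolding D_def by fastforce
    then have "s \<in> fst ` L \<union> fst ` R" by (auto intro: rev_image_eqI)
    with st have s: "(s, t) \<in> G" "s \<in> D" using return_D LR by auto
    from Suc.IH[OF s(2)] obtain x where x: "x \<in> mahavier_product X (G\<inverse>) m" "x 1 = s" by blast
    let ?e = "\<lambda>i\<in>{1..2}. if i = 1 then t else s"
    have "?e \<in> mahavier_product X (G\<inverse>) 1"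
      using s Suc.prems DX by (intro mahavier_product_single_edge) auto
    from path_join_mahavier_product[OF this x(1)] x(2)
    have "path_join 1 ?e x \<in> mahavier_product X (G\<inverse>) (Suc m)" by simp
    then show ?case by (rule bexI[rotated]) (simp add: path_join_def)
  qed

  have branch: "\<exists>E \<subseteq> {x \<in> mahavier_product X (G\<inverse>) m. x 1 = t}.
      finite E \<and> card E = 2 ^ k \<and> separated \<epsilon> (m + 1) E"
    if "t \<in> D" "m \<ge> k * (N + 1)" for k m t
    using that
  proof (induction k arbitrary: t m)
    case 0
    then obtain x where "x \<in> mahavier_product X (G\<inverse>) m" "x 1 = t" using prolong by blast
    then show ?case by (intro exI[of _ "{x}"]) (simp add: separated_def)
  next
    case (Suc k)
    obtain i a where i: "i \<in> {1..N}" and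
      a: "a \<in> mahavier_product X (G\<inverse>) i" "a 1 = t" "a (i + 1) \<in> T"
      using reach[OF Suc.prems(1)] by blast
    obtain l r where lr: "l \<in> D" "r \<in> D" "(l, a (i+1)) \<in> G" "(r, a (i+1)) \<in> G" "dist l r \<ge> \<epsilon>"
      using fork[OF a(3)] by blast
    define to where "to = (\<lambda>s. path_join i a (\<lambda>j\<in>{1..2}. if j = 1 then a (i+1) else s))"
    have to: "to s \<in> mahavier_product X (G\<inverse>) (i + 1)" "to s (i + 1 + 1) = s" "to s 1 = t"
      if "(s, a (i+1)) \<in> G" for s
    proof -
      have "(\<lambda>j\<in>{1..2}. if j = 1 then a (i+1) else s) \<in> mahavier_product X (G\<inverse>) 1"
        using that G by (intro mahavier_product_single_edge) auto
      then show "to s \<in> mahavier_product X (G\<inverse>) (i + 1)"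
        unfolding to_def by (intro path_join_mahavier_product a) auto
      show "to s (i + 1 + 1) = s" "to s 1 = t"
        using i a(2) by (auto simp: to_def path_join_def)
    qed
    \<comment> \<open>The walk to the fork and the step through it take \<open>i + 1 \<le> N + 1\<close> of the \<open>m\<close> steps.\<close>
    define q where "q = m - (i + 1)"
    have q: "q \<ge> k * (N + 1)" "i + 1 + q = m" using Suc.prems(2) i by (auto simp: q_def)
    obtain A where A: "A \<subseteq> {x \<in> mahavier_product X (G\<inverse>) q. x 1 = l}" "finite A" "card A = 2 ^ k"
      "separated \<epsilon> (q + 1) A" using Suc.IH[OF lr(1) q(1)] by blast
    obtain B where B: "B \<subseteq> {x \<in> mahavier_product X (G\<inverse>) q. x 1 = r}" "finite B" "card B = 2 ^ k"
      "separated \<epsilon> (q + 1) B" using Suc.IH[OF lr(2) q(1)] by blast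
    have "\<exists>E \<subseteq> {x \<in> mahavier_product X (G\<inverse>) (i + 1 + q). x 1 = t}.
        finite E \<and> card E = card A + card B \<and> separated \<epsilon> (i + 1 + q + 1) E"
      by (rule separated_graft[OF \<epsilon> to(1,2)[OF lr(3)] to(1,2)[OF lr(4)]
            to(3)[OF lr(3)] to(3)[OF lr(4)] _ lr(5) A(1,2,4) B(1,2,4)]) simp
    then show ?case using A(3) B(3) q(2) by (simp add: mult_2)
  qed

  obtain t where t: "t \<in> D" using LR(1) by (auto simp: D_def)
  have "\<exists>E \<subseteq> mahavier_product X (G\<inverse>) (k * (N + 1)).
      card E = 2 ^ k \<and> separated \<epsilon> (k * (N + 1) + 1) E" for k
  proof -
    from branch[OF t order_refl, of k]
    obtain E where "E \<subseteq> {x \<in> mahavier_product X (G\<inverse>) (k * (N + 1)). x 1 = t}"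
      "card E = 2 ^ k" "separated \<epsilon> (k * (N + 1) + 1) E" by blast
    then show ?thesis by (intro exI[of _ E]) auto
  qed
  moreover have "N + 1 \<ge> 1" by simp
  ultimately show ?thesis using \<epsilon> by blast
qed

theorem corollary5:
  fixes X :: "'a::metric_space set" and G :: "('a \<times> 'a) set"
  assumes "compact X"
    and "closed_relation X G"
    and "well_aligned X G \<or> well_aligned X (G\<inverse>)"
  shows "ent X G \<noteq> 0"
proof -
  have G: "G \<subseteq> X \<times> X"
    using assms(2) closedin_imp_subset unfolding closed_relation_def by blast
  have X: "X \<noteq> {}"
    using assms(3) G unfolding well_aligned_def well_aligned_sets_def by blast
  have "\<exists>\<epsilon>>0. \<exists>p\<ge>1. \<forall>k. \<exists>E \<subseteq> mahavier_product X (G\<inverse>) (k * p).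
      card E = 2 ^ k \<and> separated \<epsilon> (k * p + 1) E"
    using assms(3)
  proof
    assume "well_aligned X G"
    then show ?thesis
      using well_aligned_sets_exponential_separation[OF _ G] unfolding well_aligned_def by blast
  next
    assume "well_aligned X (G\<inverse>)"
    then obtain L R where "well_aligned_sets X (G\<inverse>) L R" unfolding well_aligned_def by blast
    moreover have "G\<inverse> \<subseteq> X \<times> X" using G by blast
    ultimately obtain \<epsilon> p where "\<epsilon> > 0" "p \<ge> 1" and
      "\<forall>k. \<exists>E \<subseteq> mahavier_product X G (k * p). card E = 2 ^ k \<and> separated \<epsilon> (k * p + 1) E"
      using well_aligned_sets_exponential_separation[of X "G\<inverse>" L R] by auto
    then show ?thesis using separated_reverse[of _ X G _ \<epsilon>] by metis
  qed
  then obtain \<epsilon> p where "\<epsilon> > 0" "p \<ge> 1" and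
    "\<And>k. \<exists>E \<subseteq> mahavier_product X (G\<inverse>) (k * p). card E = 2 ^ k \<and> separated \<epsilon> (k * p + 1) E"
    by blast
  from ent_pos_of_exponential_separation[OF assms(1) X this] show ?thesis by simp
qed

end
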